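(* For every integer $n\geq 1$, the polynomial $L_n(q)$ has only real zeros.
   Context: Define polynomials $b_n(q)$, $n\geq 1$, by $b_1(q)=1$ and $b_{2n}(q)=b_n(q)$, $b_{4n+1}(q)=q\,b_{2n}(q)+b_{2n+1}(q)$, $b_{4n+3}(q)=b_{2n+1}(q)+q\,b_{2n+2}(q)$ (for all indices for which these make sense, i.e. the indices on the right are $\geq 1$). For $n\geq 1$ let $L_n(q)=2\left(\sum_{k=1}^{2^n-1}b_k(q)\right)+b_{2^n}(q)$. (These $b_n(q)$ are the Eulerian polynomials of the intervals of the Stern poset.) *)

theory Defs
  imports Complex_Main "HOL-Computational_Algebra.Polynomial"
begin

(* The sequence is indexed from 1; the value at 0 is a dummy that no other equation refers to. *)
function stern_b :: "nat \<Rightarrow> real poly" where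
  "stern_b 0 = 0"
| "stern_b (Suc 0) = 1"
| "n \<ge> 1 \<Longrightarrow> stern_b (2 * n) = stern_b n"
| "n \<ge> 1 \<Longrightarrow> stern_b (4 * n + 1) = [:0, 1:] * stern_b (2 * n) + stern_b (2 * n + 1)"
| "stern_b (4 * n + 3) = stern_b (2 * n + 1) + [:0, 1:] * stern_b (2 * n + 2)"
proof -
  fix P :: bool and x :: nat
  assume 0: "x = 0 \<Longrightarrow> P" and 1: "x = Suc 0 \<Longrightarrow> P"
    and ev: "\<And>n. n \<ge> 1 \<Longrightarrow> x = 2 * n \<Longrightarrow> P"
    and o1: "\<And>n. n \<ge> 1 \<Longrightarrow> x = 4 * n + 1 \<Longrightarrow> P"
    and o3: "\<And>n. x = 4 * n + 3 \<Longrightarrow> P"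
  have "x = 0 \<or> x = Suc 0 \<or> (\<exists>n\<ge>1. x = 2 * n) \<or> (\<exists>n\<ge>1. x = 4 * n + 1) \<or> (\<exists>n. x = 4 * n + 3)"
    by presburger
  then show P
    using 0 1 ev o1 o3 by blast
qed (presburger | simp)+
termination
  by (relation "measure id") auto

definition stern_L :: "nat \<Rightarrow> real poly" where
  "stern_L n = 2 * (\<Sum>k = 1..2 ^ n - 1. stern_b k) + stern_b (2 ^ n)"

(* All complex zeros are real. A nonzero constant satisfies this vacuously; the zero polynomial does not. *)
definition only_real_zeros :: "real poly \<Rightarrow> bool" where
  "only_real_zeros p \<longleftrightarrow> (\<forall>z::complex. poly (map_poly of_real p) z = 0 \<longrightarrow> z \<in> \<real>)"

end

theory Submission
  imports Defs
begin

text \<open>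
  Since $b_0 = 0$, $L_n$ is the trapezoidal sum of $b_k + b_{k+1}$ over $k < 2^n$. With $O_n$ the
  sum of $b_{2k+1}$ over $k < 2^n$, grouping the summands in pairs gives $L_{n+1} = L_n + 2 O_n$
  and $O_{n+1} = q L_n + 2 O_n$, hence $L_{n+2} = 3 L_{n+1} - 2(1-q) L_n$ with $L_0 = 1$ and
  $L_1 = 3$. So if $\alpha + \beta = 3$ and $\alpha\beta = 2(1-q)$, then
  $(\alpha - \beta) L_n(q) = \alpha^{n+1} - \beta^{n+1}$. At a complex zero $q$ of $L_n$ this
  forces $|\alpha| = |\beta|$; as $\alpha + \beta$ is real and nonzero, $\alpha$ and $\beta$ are
  conjugate, so $\alpha\beta$ and with it $q$ are real.
\<close>

lemma sum_lessThan_double: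
  fixes f :: "nat \<Rightarrow> 'a::comm_monoid_add"
  shows "(\<Sum>k<2 * n. f k) = (\<Sum>k<n. f (2 * k) + f (2 * k + 1))"
  by (induction n) (simp_all add: add.assoc)

lemma sum_lessThan_add_shift:
  fixes f :: "nat \<Rightarrow> 'a::comm_semiring_1"
  shows "(\<Sum>k<Suc n. f k + f (k + 1)) = f 0 + 2 * (\<Sum>k = 1..n. f k) + f (Suc n)"
  by (induction n) (simp_all add: algebra_simps mult_2)

text \<open>The dummy value 0 at index 0 extends the recursion equations to index 0.\<close>

lemma stern_b_double: "stern_b (2 * n) = stern_b n"
  by (cases "n = 0") simp_all

lemma stern_b_4n_plus_1: "stern_b (4 * n + 1) = [:0, 1:] * stern_b n + stern_b (2 * n + 1)"
  by (cases "n = 0") (use stern_b.simps(4)[of n] in \<open>simp_all add: stern_b_double\<close>)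

lemma stern_b_4n_plus_3: "stern_b (4 * n + 3) = stern_b (2 * n + 1) + [:0, 1:] * stern_b (n + 1)"
  using stern_b.simps(5)[of n] stern_b_double[of "n + 1"] by simp

lemma stern_L_eq_trapezoidal_sum: "stern_L n = (\<Sum>k<2 ^ n. stern_b k + stern_b (k + 1))"
proof -
  obtain m where "2 ^ n = Suc m"
    by (metis not0_implies_Suc power_not_zero zero_neq_numeral)
  then show ?thesis
    using sum_lessThan_add_shift[of stern_b m] by (simp add: stern_L_def)
qed

definition stern_odd_sum :: "nat \<Rightarrow> real poly" where
  "stern_odd_sum n = (\<Sum>k<2 ^ n. stern_b (2 * k + 1))"

lemma stern_L_Suc: "stern_L (Suc n) = stern_L n + 2 * stern_odd_sum n"
proof -
  have summand_pair: "(stern_b (2 * k) + stern_b (2 * k + 1))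
        + (stern_b (2 * k + 1) + stern_b (2 * k + 1 + 1))
      = (stern_b k + stern_b (k + 1)) + 2 * stern_b (2 * k + 1)" for k
    using stern_b_double[of k] stern_b_double[of "k + 1"] by (simp add: algebra_simps)
  show ?thesis
    unfolding stern_L_eq_trapezoidal_sum stern_odd_sum_def power_Suc sum_lessThan_double
      summand_pair
    by (simp only: sum.distrib sum_distrib_left)
qed

lemma stern_odd_sum_Suc: "stern_odd_sum (Suc n) = [:0, 1:] * stern_L n + 2 * stern_odd_sum n"
proof -
  have summand_pair: "stern_b (2 * (2 * k) + 1) + stern_b (2 * (2 * k + 1) + 1)
      = [:0, 1:] * (stern_b k + stern_b (k + 1)) + 2 * stern_b (2 * k + 1)" for k
  proof -
    have "2 * (2 * k) + 1 = 4 * k + 1" "2 * (2 * k + 1) + 1 = 4 * k + 3"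
      by simp_all
    then show ?thesis
      by (simp only: stern_b_4n_plus_1 stern_b_4n_plus_3) (simp only: algebra_simps mult_2)
  qed
  show ?thesis
    unfolding stern_L_eq_trapezoidal_sum stern_odd_sum_def power_Suc sum_lessThan_double
      summand_pair
    by (simp only: sum.distrib distrib_left sum_distrib_left)
qed

lemma stern_L_recurrence: "stern_L (Suc (Suc n)) = 3 * stern_L (Suc n) - [:2, -2:] * stern_L n"
proof -
  have "[:2, -2:] = (2 - 2 * [:0, 1:] :: real poly)"
    by (simp add: numeral_poly)
  then show ?thesis
    by (simp only: stern_L_Suc stern_odd_sum_Suc) (simp only: algebra_simps)
qed

lemma stern_L_0: "stern_L 0 = 1"
  by (simp add: stern_L_def)

lemma stern_L_1: "stern_L 1 = 3"
  by (simp add: stern_L_Suc stern_L_0 stern_odd_sum_def)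

lemma binet_formula:
  fixes \<alpha> \<beta> :: "'a::comm_ring_1"
  assumes init: "u 1 = (\<alpha> + \<beta>) * u 0"
    and rec: "\<And>n. u (Suc (Suc n)) = (\<alpha> + \<beta>) * u (Suc n) - \<alpha> * \<beta> * u n"
  shows "(\<alpha> - \<beta>) * u n = (\<alpha> ^ Suc n - \<beta> ^ Suc n) * u 0"
proof (induction n rule: induct_nat_012)
  case (ge2 n)
  have "(\<alpha> - \<beta>) * u (Suc (Suc n)) =
      (\<alpha> + \<beta>) * ((\<alpha> - \<beta>) * u (Suc n)) - \<alpha> * \<beta> * ((\<alpha> - \<beta>) * u n)"
    by (simp add: rec algebra_simps)
  then show ?case
    unfolding ge2 by (simp add: algebra_simps)
qed (use init in \<open>simp_all add: algebra_simps\<close>)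

lemma complex_sum_prod_obtain:
  fixes s p :: complex
  obtains \<alpha> \<beta> where "\<alpha> + \<beta> = s" "\<alpha> * \<beta> = p"
proof
  define w where "w = csqrt (s\<^sup>2 - 4 * p)"
  have "w\<^sup>2 = s\<^sup>2 - 4 * p"
    by (simp add: w_def)
  then show "(s + w) / 2 * ((s - w) / 2) = p"
    by (simp add: field_simps power2_eq_square)
  show "(s + w) / 2 + (s - w) / 2 = s"
    by (simp add: field_simps)
qed

lemma eq_cnj_if_norm_eq:
  assumes norm_eq: "norm \<alpha> = norm \<beta>"
    and sum_Reals: "\<alpha> + \<beta> \<in> \<real>"
    and sum_nonzero: "\<alpha> + \<beta> \<noteq> 0"
  shows "\<beta> = cnj \<alpha>"
proof -
  have Im_eq: "Im \<beta> = - Im \<alpha>"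
    using sum_Reals by (simp add: complex_is_Real_iff)
  have "(norm \<alpha>)\<^sup>2 = (norm \<beta>)\<^sup>2"
    using norm_eq by simp
  then have "(Re \<alpha>)\<^sup>2 = (Re \<beta>)\<^sup>2"
    by (simp add: cmod_power2 Im_eq)
  moreover have "Re \<alpha> \<noteq> - Re \<beta>"
    using sum_nonzero Im_eq by (simp add: complex_eq_iff)
  ultimately have "Re \<beta> = Re \<alpha>"
    by (auto simp: power2_eq_iff)
  with Im_eq show ?thesis
    by (simp add: complex_eq_iff)
qed

lemma second_order_recurrence_zero_imp_Reals:
  fixes u :: "nat \<Rightarrow> complex"
  assumes init: "u 0 \<noteq> 0" "u 1 = s * u 0"
    and rec: "\<And>n. u (Suc (Suc n)) = s * u (Suc n) - p * u n"
    and s: "s \<in> \<real>" "s \<noteq> 0"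
    and zero: "u n = 0"
  shows "p \<in> \<real>"
proof -
  obtain \<alpha> \<beta> where sum: "\<alpha> + \<beta> = s" and prod: "\<alpha> * \<beta> = p"
    by (rule complex_sum_prod_obtain)
  have "(\<alpha> - \<beta>) * u n = (\<alpha> ^ Suc n - \<beta> ^ Suc n) * u 0"
    by (rule binet_formula) (use init rec in \<open>simp_all add: sum prod\<close>)
  then have "\<alpha> ^ Suc n = \<beta> ^ Suc n"
    using init(1) zero by simp
  then have "norm \<alpha> ^ Suc n = norm \<beta> ^ Suc n"
    by (metis norm_power)
  then have "norm \<alpha> = norm \<beta>"
    by (rule power_inject_base) simp_all
  then have "\<beta> = cnj \<alpha>"
    using s sum by (intro eq_cnj_if_norm_eq) simp_all
  then show ?thesis
    using prod by (auto simp: complex_is_Real_iff)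
qed

lemma map_poly_of_real_diff:
  "map_poly of_real (p - r) = (map_poly of_real p - map_poly of_real r :: 'a::real_algebra_1 poly)"
  by (simp add: poly_eq_iff coeff_map_poly)

lemma map_poly_of_real_mult:
  "map_poly of_real (p * r) =
    (map_poly of_real p * map_poly of_real r :: 'a::{real_algebra_1, comm_ring_1} poly)"
  by (simp add: poly_eq_iff coeff_map_poly coeff_mult)

lemma map_poly_of_real_numeral:
  "map_poly of_real (numeral m) = (numeral m :: 'a::{real_algebra_1, comm_ring_1} poly)"
  by (simp add: numeral_poly map_poly_pCons)

theorem theorem2p3:
  fixes n :: nat
  assumes "n \<ge> 1"
  shows "only_real_zeros (stern_L n)"
  unfolding only_real_zeros_def
proof (intro allI impI)
  fix z :: complex
  define u where "u k = poly (map_poly of_real (stern_L k)) z" for k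
  assume "poly (map_poly of_real (stern_L n)) z = 0"
  then have zero: "u n = 0"
    by (simp add: u_def)
  have init: "u 0 \<noteq> 0" "u 1 = 3 * u 0"
    unfolding u_def stern_L_0 stern_L_1 by (simp_all add: map_poly_of_real_numeral)
  have rec: "u (Suc (Suc k)) = 3 * u (Suc k) - (2 - 2 * z) * u k" for k
    unfolding u_def stern_L_recurrence map_poly_of_real_diff map_poly_of_real_mult
      map_poly_of_real_numeral
    by (simp add: map_poly_pCons algebra_simps)
  have "2 - 2 * z \<in> \<real>"
    by (rule second_order_recurrence_zero_imp_Reals[OF init rec _ _ zero]) simp_all
  then show "z \<in> \<real>"
    by (simp add: complex_is_Real_iff)
qed

end
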